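(* Let $\Bbbk$ be a field and let $\mathbb{A}$ be the $\Bbbk$-algebra generated by $y_1,y_2,x_1,x_2$ subject to the relations $$x_2x_1=x_1x_2,\quad y_2y_1=y_1y_2+y_1^2,\quad y_1x_1=x_1y_1,\quad y_2x_1=x_1y_2,$$ $$y_1x_2=x_2y_1+x_1y_2,\quad y_2x_2=-2x_2y_1-x_1y_2+x_2y_2.$$ Let $S\subset\Bbbk\{y_1,y_2,x_1,x_2\}$ be the set consisting of the six polynomials $$x_2x_1-x_1x_2,\quad x_1y_1-y_1x_1,\quad x_1y_2-y_2x_1,\quad y_2y_1-y_1y_2-y_1^2,$$ $$x_2y_1-y_1x_2+y_2x_1,\quad x_2y_2-y_2x_2-2y_1x_2+y_2x_1.$$ Then, with respect to the degree lexicographic order with $y_1\prec y_2\prec x_1\prec x_2$, the set $S$ is a Gröbner-Shirshov basis of the ideal $\mathrm{Id}(S)$, which is the ideal of defining relations of $\mathbb{A}$, i.e. $\mathbb{A}=\Bbbk\{y_1,y_2,x_1,x_2\}/\mathrm{Id}(S)$.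
   Context: Let $X=\{y_1,y_2,x_1,x_2\}$, let $X^*$ be the free monoid of words in $X$, and let $\Bbbk\{X\}$ be the free associative unital $\Bbbk$-algebra on $X$ (noncommutative polynomials). $\mathrm{Id}(S)$ denotes the two-sided ideal of $\Bbbk\{X\}$ generated by $S$. The degree lexicographic order $\prec$ on $X^*$ compares words first by length and then, for equal length, lexicographically from left to right with $y_1\prec y_2\prec x_1\prec x_2$. For a nonzero $f\in\Bbbk\{X\}$, $\overline{f}$ denotes its leading (i.e. $\prec$-largest) word; $f$ is monic if the coefficient of $\overline{f}$ is $1$. For monic $f,g$: (i) if $w=\overline{f}a=b\overline{g}$ with $a,b\in X^*$ and $|\overline{f}|+|\overline{g}|>|w|$, then $(f,g)_w:=fa-bg$ is the intersection composition; (ii) if $w=\overline{f}=a\overline{g}b$ with $a,b\in X^*$, then $(f,g)_w:=f-agb$ is the inclusion composition. A composition $(f,g)_w$ is trivial modulo $S$ if $(f,g)_w=\sum_i\alpha_i a_is_ib_i$ (finite sum) with $\alpha_i\in\Bbbk$, $a_i,b_i\in X^*$, $s_i\in S$ and $a_i\overline{s_i}b_i\prec w$ for all $i$. A nonempty set $S$ of monic polynomials is a Gröbner-Shirshov basis of $\mathrm{Id}(S)$ if every composition $(f,g)_w$ with $f,g\in S$ is trivial modulo $S$. *)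

theory Defs
  imports "HOL-Algebra.QuotRing" "HOL-Algebra.Module"
    "HOL-Library.Poly_Mapping" "HOL-Library.List_Lenlexorder"
begin

section \<open>Words and noncommutative polynomials\<close>

text \<open>
  The free monoid of words over \<^typ>\<open>'x\<close> is the type \<^typ>\<open>'x list\<close> under concatenation. It is
  written additively only because \<^typ>\<open>'a \<Rightarrow>\<^sub>0 'k\<close> takes the convolution product from the
  addition of its exponents: with this instance, \<^typ>\<open>'x list \<Rightarrow>\<^sub>0 'k\<close> is the monoid algebra
  of the free monoid, i.e. the free associative unital algebra over \<^typ>\<open>'k\<close> on \<^typ>\<open>'x\<close>.
  The order \<open><\<close> on words is the one of \<^theory>\<open>HOL-Library.List_Lenlexorder\<close>: first by length, and
  for equal length lexicographically from left to right.
\<close>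

instantiation list :: (type) monoid_add
begin

definition zero_list :: "'a list" where "zero_list = []"

definition plus_list :: "'a list \<Rightarrow> 'a list \<Rightarrow> 'a list" where "plus_list u v = u @ v"

instance
  by standard (simp_all add: zero_list_def plus_list_def)

end

type_synonym ('x, 'k) ncpoly = "'x list \<Rightarrow>\<^sub>0 'k"

definition word :: "'x list \<Rightarrow> ('x, 'k::field) ncpoly"
  where "word u = Poly_Mapping.single u 1"

definition scale :: "'k \<Rightarrow> ('x, 'k::field) ncpoly \<Rightarrow> ('x, 'k) ncpoly"
  where "scale c f = Poly_Mapping.single [] c * f"

definition lead_word :: "('x::linorder, 'k::field) ncpoly \<Rightarrow> 'x list"
  where "lead_word f = Max (Poly_Mapping.keys f)"

definition monic :: "('x::linorder, 'k::field) ncpoly \<Rightarrow> bool"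
  where "monic f \<longleftrightarrow> f \<noteq> 0 \<and> Poly_Mapping.lookup f (lead_word f) = 1"


section \<open>Compositions and Groebner-Shirshov bases\<close>

text \<open>\<open>composition f g w h\<close>: the polynomial \<open>h\<close> is a composition \<open>(f, g)\<^sub>w\<close>.\<close>

inductive composition ::
  "('x::linorder, 'k::field) ncpoly \<Rightarrow> ('x, 'k) ncpoly \<Rightarrow> 'x list \<Rightarrow> ('x, 'k) ncpoly \<Rightarrow> bool"
  for f g where
  intersection:
    "\<lbrakk>w = lead_word f @ a; w = b @ lead_word g;
      length (lead_word f) + length (lead_word g) > length w\<rbrakk>
     \<Longrightarrow> composition f g w (f * word a - word b * g)"
| inclusion:
    "\<lbrakk>w = lead_word f; w = a @ lead_word g @ b\<rbrakk>
     \<Longrightarrow> composition f g w (f - word a * g * word b)"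

definition trivial_modulo ::
  "('x::linorder, 'k::field) ncpoly set \<Rightarrow> 'x list \<Rightarrow> ('x, 'k) ncpoly \<Rightarrow> bool"
  where "trivial_modulo S w h \<longleftrightarrow>
    (\<exists>(n::nat) \<alpha> a s b.
      h = (\<Sum>i<n. scale (\<alpha> i) (word (a i) * s i * word (b i))) \<and>
      (\<forall>i<n. s i \<in> S \<and> a i @ lead_word (s i) @ b i < w))"

definition GS_basis :: "('x::linorder, 'k::field) ncpoly set \<Rightarrow> bool"
  where "GS_basis S \<longleftrightarrow> S \<noteq> {} \<and> (\<forall>f\<in>S. monic f) \<and>
    (\<forall>f\<in>S. \<forall>g\<in>S. \<forall>w h. composition f g w h \<longrightarrow> trivial_modulo S w h)"


section \<open>Presented algebras\<close>

text \<open>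
  The record type \<^typ>\<open>('k, 'a) module\<close> carries a ring structure on \<^typ>\<open>'a\<close> together with a scalar
  multiplication by \<^typ>\<open>'k\<close>, hence serves for (noncommutative) algebras as well.
\<close>

definition free_algebra :: "('k::field, ('x, 'k) ncpoly) module"
  where "free_algebra =
    \<lparr>carrier = UNIV, mult = (*), one = 1, zero = 0, add = (+), smult = scale\<rparr>"

definition ideal_gen :: "('x, 'k::field) ncpoly set \<Rightarrow> ('x, 'k) ncpoly set"
  where "ideal_gen S = Idl\<^bsub>free_algebra\<^esub> S"

text \<open>The quotient ring \<open>F Quot I\<close>, with the scalar multiplication induced from \<open>F\<close>.\<close>

definition quotient_algebra :: "('k, 'a, 'm) module_scheme \<Rightarrow> 'a set \<Rightarrow> ('k, 'a set) module"
  where "quotient_algebra F I =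
    ring.extend (F Quot I) (module.fields (\<lambda>c A. \<Union>a\<in>A. I +>\<^bsub>F\<^esub> (c \<odot>\<^bsub>F\<^esub> a)))"

text \<open>A relation \<open>l = r\<close> is given as the pair \<open>(l, r)\<close>.\<close>

definition relations_ideal :: "(('x, 'k::field) ncpoly \<times> ('x, 'k) ncpoly) set \<Rightarrow> ('x, 'k) ncpoly set"
  where "relations_ideal E = ideal_gen {l - r | l r. (l, r) \<in> E}"

definition presented_algebra ::
  "(('x, 'k::field) ncpoly \<times> ('x, 'k) ncpoly) set \<Rightarrow> ('k, ('x, 'k) ncpoly set) module"
  where "presented_algebra E = quotient_algebra free_algebra (relations_ideal E)"


section \<open>The alphabet\<close>

datatype letter = Y1 | Y2 | X1 | X2

primrec letter_rank :: "letter \<Rightarrow> nat" where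
  "letter_rank Y1 = 0"
| "letter_rank Y2 = 1"
| "letter_rank X1 = 2"
| "letter_rank X2 = 3"

instantiation letter :: linorder
begin

definition less_eq_letter :: "letter \<Rightarrow> letter \<Rightarrow> bool"
  where "p \<le> q \<longleftrightarrow> letter_rank p \<le> letter_rank q"

definition less_letter :: "letter \<Rightarrow> letter \<Rightarrow> bool"
  where "p < q \<longleftrightarrow> letter_rank p < letter_rank q"

instance
proof
  fix p q :: letter
  show "p = q" if "p \<le> q" "q \<le> p"
    using that by (cases p; cases q) (simp_all add: less_eq_letter_def)
qed (auto simp: less_eq_letter_def less_letter_def)

end

definition y\<^sub>1 :: "(letter, 'k::field) ncpoly" where "y\<^sub>1 = word [Y1]"
definition y\<^sub>2 :: "(letter, 'k::field) ncpoly" where "y\<^sub>2 = word [Y2]"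
definition x\<^sub>1 :: "(letter, 'k::field) ncpoly" where "x\<^sub>1 = word [X1]"
definition x\<^sub>2 :: "(letter, 'k::field) ncpoly" where "x\<^sub>2 = word [X2]"

end

theory Submission
  imports Defs
begin

text \<open>
  The leading words of the six polynomials are exactly the strictly descending words of length two,
  each occurring once. Hence an inclusion, or an overlap of two letters, can only compare a
  polynomial with itself and gives the composition 0; the other compositions come from overlaps in
  one letter (\<open>composition_quadratic\<close>), that is, from the strictly descending words of length three:
  \<open>x\<^sub>2x\<^sub>1y\<^sub>1\<close>, \<open>x\<^sub>2x\<^sub>1y\<^sub>2\<close>, \<open>x\<^sub>1y\<^sub>2y\<^sub>1\<close>, \<open>x\<^sub>2y\<^sub>2y\<^sub>1\<close>. For each of them, both
  ways of rewriting the word lead to the same normal form; recording the rules used along the way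
  expresses the composition through elements \<open>a s b\<close> with smaller leading words.

  Every polynomial of the set is an integral linear combination of the differences \<open>l - r\<close> of the
  defining relations \<open>l = r\<close>, and conversely; so both generate the same ideal, and the quotients agree.
\<close>

section \<open>Words as polynomials\<close>

lemma word_Nil: "word [] = 1"
  by (simp add: word_def single_one[symmetric] zero_list_def)

lemma word_mult: "word u * word v = word (u @ v)"
  by (simp add: word_def mult_single plus_list_def)

lemma keys_word: "Poly_Mapping.keys (word u :: ('x, 'k::field) ncpoly) = {u}"
  by (simp add: word_def)

lemma scale_1: "scale 1 f = f"
  by (simp add: scale_def word_def[symmetric] word_Nil)

lemma scale_add_left: "scale (c + d) f = scale c f + scale d f"
  by (simp add: scale_def single_add distrib_right)

lemma scale_minus_left: "scale (- c) f = - scale c f"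
  by (simp add: scale_def single_uminus)

lemma scale_2: "scale 2 f = f + f"
  using scale_add_left[of 1 1 f] by (simp add: scale_1)

lemmas scale_numerals = scale_2 scale_minus_left

lemma
  fixes g :: "('x::linorder, 'k::field) ncpoly"
  assumes "\<forall>v\<in>Poly_Mapping.keys g. v < u"
  shows lead_word_word_add: "lead_word (word u + g) = u"
    and monic_word_add: "monic (word u + g)"
proof -
  have "Poly_Mapping.lookup g u = 0"
    using assms by (auto simp: in_keys_iff)
  then have coeff: "Poly_Mapping.lookup (word u + g) u = 1"
    by (simp add: lookup_add word_def)
  then have u: "u \<in> Poly_Mapping.keys (word u + g)"
    by (simp add: in_keys_iff)
  have "v \<le> u" if "v \<in> Poly_Mapping.keys (word u + g)" for v
  proof -
    have "v = u \<or> v \<in> Poly_Mapping.keys g"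
      using Poly_Mapping.keys_add[of "word u" g] that by (auto simp: keys_word)
    then show ?thesis
      using assms by (auto intro: less_imp_le)
  qed
  then show lead: "lead_word (word u + g) = u"
    unfolding lead_word_def using u by (intro Max_eqI) auto
  show "monic (word u + g)"
    using coeff u by (auto simp: monic_def lead)
qed

lemma keys_less_add:
  assumes "\<forall>v\<in>Poly_Mapping.keys f. v < u" "\<forall>v\<in>Poly_Mapping.keys g. v < u"
  shows "\<forall>v\<in>Poly_Mapping.keys (f + g). v < u"
  using assms Poly_Mapping.keys_add[of f g] by blast

lemma keys_less_uminus_word:
  fixes u v :: "'x::linorder list"
  shows "v < u \<Longrightarrow> \<forall>t\<in>Poly_Mapping.keys (- word v :: ('x, 'k::field) ncpoly). t < u"
  by (simp add: keys_word)

lemma keys_less_word: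
  fixes u v :: "'x::linorder list"
  shows "v < u \<Longrightarrow> \<forall>t\<in>Poly_Mapping.keys (word v :: ('x, 'k::field) ncpoly). t < u"
  by (simp add: keys_word)

text \<open>As a simplification rule, this decides the order between explicit words of equal length.\<close>

lemma letter_word_less_Cons:
  fixes p q :: letter
  shows "p # u < q # v \<longleftrightarrow> length u < length v \<or>
    length u = length v \<and> (letter_rank p < letter_rank q \<or> p = q \<and> u < v)"
  by (auto simp: list_less_def lenlex_conv less_letter_def)


section \<open>Trivial polynomials\<close>

lemma trivial_modulo_0: "trivial_modulo S w 0"
  unfolding trivial_modulo_def by (rule exI[of _ 0]) auto

lemma trivial_modulo_add_scale:
  assumes "trivial_modulo S w h" "s \<in> S" "a @ lead_word s @ b < w"
  shows "trivial_modulo S w (h + scale c (word a * s * word b))"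
proof -
  obtain n :: nat and \<alpha> as ss bs where
    h: "h = (\<Sum>i<n. scale (\<alpha> i) (word (as i) * ss i * word (bs i)))"
    and *: "\<forall>i<n. ss i \<in> S \<and> as i @ lead_word (ss i) @ bs i < w"
    using assms(1) unfolding trivial_modulo_def by blast
  have "h + scale c (word a * s * word b) =
    (\<Sum>i<Suc n. scale ((\<alpha>(n := c)) i) (word ((as(n := a)) i) * (ss(n := s)) i * word ((bs(n := b)) i)))"
    by (simp add: h)
  moreover have "\<forall>i<Suc n. (ss(n := s)) i \<in> S \<and>
      (as(n := a)) i @ lead_word ((ss(n := s)) i) @ (bs(n := b)) i < w"
    using * assms(2,3) by (simp add: less_Suc_eq)
  ultimately show ?thesis
    unfolding trivial_modulo_def by blast
qed

lemma trivial_modulo_add: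
  "trivial_modulo S w h \<Longrightarrow> s \<in> S \<Longrightarrow> a @ lead_word s @ b < w \<Longrightarrow>
    trivial_modulo S w (h + word a * s * word b)"
  using trivial_modulo_add_scale[of S w h s a b 1] by (simp add: scale_1)

lemma trivial_modulo_diff:
  "trivial_modulo S w h \<Longrightarrow> s \<in> S \<Longrightarrow> a @ lead_word s @ b < w \<Longrightarrow>
    trivial_modulo S w (h - word a * s * word b)"
  using trivial_modulo_add_scale[of S w h s a b "- 1"] by (simp add: scale_1 scale_minus_left)


section \<open>Compositions of polynomials with leading words of length two\<close>

text \<open>
  The length bound in an intersection composition leaves an overlap of one or two letters. An overlap
  of two letters is a coincidence of the leading words, as is an inclusion.
\<close>

lemma composition_quadratic:
  assumes "composition f g w h" "length (lead_word f) = 2" "length (lead_word g) = 2"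
  obtains
    "lead_word f = lead_word g" "h = f - g"
  | p q r where "lead_word f = [p, q]" "lead_word g = [q, r]" "w = [p, q, r]"
      "h = f * word [r] - word [p] * g"
  using assms(1)
proof cases
  case (intersection a b)
  obtain p q r s where f: "lead_word f = [p, q]" and g: "lead_word g = [r, s]"
    using assms(2,3) by (auto simp: numeral_2_eq_2 length_Suc_conv)
  have eq: "[p, q] @ a = b @ [r, s]"
    using intersection f g by simp
  have "length a < 2"
    using intersection assms(2,3) by simp
  then consider "a = []" | t where "a = [t]"
    by (cases a) auto
  then show thesis
  proof cases
    case 1
    then have "b = []" "[p, q] = [r, s]"
      using eq arg_cong[OF eq, of length] by auto
    then show thesis
      using 1 intersection that(1) f g by (simp add: word_Nil)
  next
    case (2 t)
    then have "length b = Suc 0"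
      using arg_cong[OF eq, of length] by simp
    then obtain u where "b = [u]"
      by (auto simp: length_Suc_conv)
    then show thesis
      using 2 eq intersection f g by (intro that(2)[of p q t]) auto
  qed
next
  case (inclusion a b)
  then have "lead_word f = a @ lead_word g @ b"
    by simp
  moreover from arg_cong[OF this, of length] have "a = []" "b = []"
    using assms(2,3) by auto
  ultimately show thesis
    using inclusion that(1) by (simp add: word_Nil)
qed


section \<open>The six polynomials\<close>

definition s_x2x1 :: "(letter, 'k::field) ncpoly"
  where "s_x2x1 = x\<^sub>2 * x\<^sub>1 - x\<^sub>1 * x\<^sub>2"

definition s_x1y1 :: "(letter, 'k::field) ncpoly"
  where "s_x1y1 = x\<^sub>1 * y\<^sub>1 - y\<^sub>1 * x\<^sub>1"

definition s_x1y2 :: "(letter, 'k::field) ncpoly"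
  where "s_x1y2 = x\<^sub>1 * y\<^sub>2 - y\<^sub>2 * x\<^sub>1"

definition s_y2y1 :: "(letter, 'k::field) ncpoly"
  where "s_y2y1 = y\<^sub>2 * y\<^sub>1 - y\<^sub>1 * y\<^sub>2 - y\<^sub>1 ^ 2"

definition s_x2y1 :: "(letter, 'k::field) ncpoly"
  where "s_x2y1 = x\<^sub>2 * y\<^sub>1 - y\<^sub>1 * x\<^sub>2 + y\<^sub>2 * x\<^sub>1"

definition s_x2y2 :: "(letter, 'k::field) ncpoly"
  where "s_x2y2 = x\<^sub>2 * y\<^sub>2 - y\<^sub>2 * x\<^sub>2 - scale 2 (y\<^sub>1 * x\<^sub>2) + y\<^sub>2 * x\<^sub>1"

definition gs_set :: "(letter, 'k::field) ncpoly set"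
  where "gs_set = {s_x2x1, s_x1y1, s_x1y2, s_y2y1, s_x2y1, s_x2y2}"

lemmas s_defs = s_x2x1_def s_x1y1_def s_x1y2_def s_y2y1_def s_x2y1_def s_x2y2_def

text \<open>Separating the leading word from the tail makes \<open>lead_word_word_add\<close> applicable.\<close>

lemma s_words:
  "s_x2x1 = word [X2, X1] + - word [X1, X2]"
  "s_x1y1 = word [X1, Y1] + - word [Y1, X1]"
  "s_x1y2 = word [X1, Y2] + - word [Y2, X1]"
  "s_y2y1 = word [Y2, Y1] + (- word [Y1, Y2] + - word [Y1, Y1])"
  "s_x2y1 = word [X2, Y1] + (- word [Y1, X2] + word [Y2, X1])"
  "s_x2y2 = word [X2, Y2] +
    (- word [Y2, X2] + (- word [Y1, X2] + (- word [Y1, X2] + word [Y2, X1])))"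
  by (simp_all add: s_defs x\<^sub>1_def x\<^sub>2_def y\<^sub>1_def y\<^sub>2_def word_mult power2_eq_square scale_2
      algebra_simps)

lemmas keys_less = keys_less_add keys_less_uminus_word keys_less_word

lemma lead_words:
  "lead_word (s_x2x1 :: (letter, 'k::field) ncpoly) = [X2, X1]"
  "lead_word (s_x1y1 :: (letter, 'k) ncpoly) = [X1, Y1]"
  "lead_word (s_x1y2 :: (letter, 'k) ncpoly) = [X1, Y2]"
  "lead_word (s_y2y1 :: (letter, 'k) ncpoly) = [Y2, Y1]"
  "lead_word (s_x2y1 :: (letter, 'k) ncpoly) = [X2, Y1]"
  "lead_word (s_x2y2 :: (letter, 'k) ncpoly) = [X2, Y2]"
  unfolding s_words
  by (rule lead_word_word_add, (intro keys_less; simp add: letter_word_less_Cons))+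

lemma monic_gs_set:
  assumes "s \<in> gs_set"
  shows "monic s"
proof -
  have
    "monic (s_x2x1 :: (letter, 'a) ncpoly)"
    "monic (s_x1y1 :: (letter, 'a) ncpoly)"
    "monic (s_x1y2 :: (letter, 'a) ncpoly)"
    "monic (s_y2y1 :: (letter, 'a) ncpoly)"
    "monic (s_x2y1 :: (letter, 'a) ncpoly)"
    "monic (s_x2y2 :: (letter, 'a) ncpoly)"
    unfolding s_words
    by (rule monic_word_add, (intro keys_less; simp add: letter_word_less_Cons))+
  then show ?thesis
    using assms by (auto simp: gs_set_def)
qed


section \<open>The four overlaps\<close>

text \<open>
  Each certificate below comes from rewriting the leading words of the six polynomials inside the
  composition until it vanishes: rewriting by \<open>s\<close> between the words \<open>a\<close> and \<open>b\<close> contributes the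
  summand \<open>a s b\<close>, up to its coefficient. A coefficient 2 is spelt out as a repeated summand.
\<close>

lemma trivial_x2x1y1:
  "trivial_modulo gs_set [X2, X1, Y1]
    (s_x2x1 * word [Y1] - word [X2] * s_x1y1 :: (letter, 'k::field) ncpoly)"
proof -
  have "(s_x2x1 * word [Y1] - word [X2] * s_x1y1 :: (letter, 'k) ncpoly) =
      0 - word [X1] * s_x2y1 * word [] - word [] * s_x1y1 * word [X2]
       + word [] * s_x1y2 * word [X1] + word [] * s_x2y1 * word [X1]
       + word [Y1] * s_x2x1 * word []"
    by (simp add: s_words word_Nil word_mult algebra_simps)
  also have "trivial_modulo gs_set [X2, X1, Y1] \<dots>"
    by (intro trivial_modulo_add trivial_modulo_diff trivial_modulo_0)
      (simp_all add: gs_set_def lead_words letter_word_less_Cons)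
  finally show ?thesis .
qed

lemma trivial_x2x1y2:
  "trivial_modulo gs_set [X2, X1, Y2]
    (s_x2x1 * word [Y2] - word [X2] * s_x1y2 :: (letter, 'k::field) ncpoly)"
proof -
  have "(s_x2x1 * word [Y2] - word [X2] * s_x1y2 :: (letter, 'k) ncpoly) =
      0 - word [X1] * s_x2y2 * word [] - word [] * s_x1y2 * word [X2]
       - word [] * s_x1y1 * word [X2] - word [] * s_x1y1 * word [X2]
       + word [] * s_x1y2 * word [X1] + word [] * s_x2y2 * word [X1]
       + word [Y2] * s_x2x1 * word [] + word [Y1] * s_x2x1 * word []
       + word [Y1] * s_x2x1 * word []"
    by (simp add: s_words word_Nil word_mult algebra_simps)
  also have "trivial_modulo gs_set [X2, X1, Y2] \<dots>"
    by (intro trivial_modulo_add trivial_modulo_diff trivial_modulo_0)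
      (simp_all add: gs_set_def lead_words letter_word_less_Cons)
  finally show ?thesis .
qed

lemma trivial_x1y2y1:
  "trivial_modulo gs_set [X1, Y2, Y1]
    (s_x1y2 * word [Y1] - word [X1] * s_y2y1 :: (letter, 'k::field) ncpoly)"
proof -
  have "(s_x1y2 * word [Y1] - word [X1] * s_y2y1 :: (letter, 'k) ncpoly) =
      0 - word [Y2] * s_x1y1 * word [] + word [] * s_x1y1 * word [Y2]
       + word [] * s_x1y1 * word [Y1] + word [Y1] * s_x1y2 * word []
       + word [Y1] * s_x1y1 * word [] - word [] * s_y2y1 * word [X1]"
    by (simp add: s_words word_Nil word_mult algebra_simps)
  also have "trivial_modulo gs_set [X1, Y2, Y1] \<dots>"
    by (intro trivial_modulo_add trivial_modulo_diff trivial_modulo_0)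
      (simp_all add: gs_set_def lead_words letter_word_less_Cons)
  finally show ?thesis .
qed

lemma trivial_x2y2y1:
  "trivial_modulo gs_set [X2, Y2, Y1]
    (s_x2y2 * word [Y1] - word [X2] * s_y2y1 :: (letter, 'k::field) ncpoly)"
proof -
  have "(s_x2y2 * word [Y1] - word [X2] * s_y2y1 :: (letter, 'k) ncpoly) =
      0 + word [] * s_x2y1 * word [Y2] + word [] * s_x2y1 * word [Y1]
       + word [Y1] * s_x2y2 * word [] - word [Y2] * s_x1y2 * word []
       - word [Y2] * s_x2y1 * word [] - word [Y1] * s_x2y1 * word []
       - word [] * s_y2y1 * word [X2]"
    by (simp add: s_words word_Nil word_mult algebra_simps)
  also have "trivial_modulo gs_set [X2, Y2, Y1] \<dots>"
    by (intro trivial_modulo_add trivial_modulo_diff trivial_modulo_0)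
      (simp_all add: gs_set_def lead_words letter_word_less_Cons)
  finally show ?thesis .
qed

theorem GS_basis_gs_set: "GS_basis (gs_set :: (letter, 'k::field) ncpoly set)"
  unfolding GS_basis_def
proof (intro conjI ballI allI impI)
  fix f g h :: "(letter, 'k) ncpoly" and w
  assume f: "f \<in> gs_set" and g: "g \<in> gs_set" and comp: "composition f g w h"
  have len: "length (lead_word s) = 2" if "s \<in> gs_set" for s :: "(letter, 'k) ncpoly"
    using that by (auto simp: gs_set_def lead_words)
  show "trivial_modulo gs_set w h"
  proof (cases rule: composition_quadratic[OF comp len[OF f] len[OF g]])
    case 1
    then have "f = g"
      using f g by (auto simp: gs_set_def lead_words)
    then show ?thesis
      using 1 by (simp add: trivial_modulo_0)
  next
    case (2 p q r)
    then have "w = [X2, X1, Y1] \<and> f = s_x2x1 \<and> g = s_x1y1 \<or>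
        w = [X2, X1, Y2] \<and> f = s_x2x1 \<and> g = s_x1y2 \<or>
        w = [X1, Y2, Y1] \<and> f = s_x1y2 \<and> g = s_y2y1 \<or>
        w = [X2, Y2, Y1] \<and> f = s_x2y2 \<and> g = s_y2y1"
      using f g unfolding gs_set_def
      by (elim insertE emptyE; simp add: lead_words)
    then show ?thesis
      using 2 trivial_x2x1y1 trivial_x2x1y2 trivial_x1y2y1 trivial_x2y2y1 by auto
  qed
qed (auto simp: gs_set_def monic_gs_set)


section \<open>Ideals of the free algebra\<close>

lemma ring_free_algebra: "ring (free_algebra :: ('k::field, ('x, 'k) ncpoly) module)"
proof (rule ringI)
  show "abelian_group (free_algebra :: ('k, ('x, 'k) ncpoly) module)"
  proof (rule abelian_groupI)
    fix f :: "('x, 'k) ncpoly"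
    show "\<exists>g\<in>carrier free_algebra. g \<oplus>\<^bsub>free_algebra\<^esub> f = \<zero>\<^bsub>free_algebra\<^esub>"
      by (rule bexI[of _ "- f"]) (simp_all add: free_algebra_def)
  qed (simp_all add: free_algebra_def algebra_simps)
  show "monoid (free_algebra :: ('k, ('x, 'k) ncpoly) module)"
    by (rule monoidI) (simp_all add: free_algebra_def algebra_simps)
qed (simp_all add: free_algebra_def algebra_simps)

lemma a_inv_free_algebra: "\<ominus>\<^bsub>free_algebra\<^esub> f = - f"
proof -
  interpret ring free_algebra by (rule ring_free_algebra)
  show ?thesis
    by (rule minus_equality) (simp_all add: free_algebra_def)
qed

lemma ideal_ideal_gen: "ideal (ideal_gen S) free_algebra"
proof -
  interpret ring free_algebra by (rule ring_free_algebra)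
  show ?thesis
    unfolding ideal_gen_def by (rule genideal_ideal) (simp add: free_algebra_def)
qed

lemma ideal_gen_base: "f \<in> S \<Longrightarrow> f \<in> ideal_gen S"
proof -
  interpret ring free_algebra by (rule ring_free_algebra)
  show "f \<in> S \<Longrightarrow> f \<in> ideal_gen S"
    unfolding ideal_gen_def using genideal_self[of S] by (auto simp: free_algebra_def)
qed

lemma ideal_gen_subset: "S \<subseteq> ideal_gen T \<Longrightarrow> ideal_gen S \<subseteq> ideal_gen T"
proof -
  interpret ring free_algebra by (rule ring_free_algebra)
  show "S \<subseteq> ideal_gen T \<Longrightarrow> ideal_gen S \<subseteq> ideal_gen T"
    unfolding ideal_gen_def[of S] by (rule genideal_minimal[OF ideal_ideal_gen])
qed

lemma ideal_gen_add:
  assumes "f \<in> ideal_gen S" "g \<in> ideal_gen S"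
  shows "f + g \<in> ideal_gen S"
  using additive_subgroup.a_closed[OF ideal.axioms(1)[OF ideal_ideal_gen] assms]
  by (simp add: free_algebra_def)

lemma ideal_gen_uminus:
  assumes "f \<in> ideal_gen S"
  shows "- f \<in> ideal_gen S"
  using additive_subgroup.a_inv_closed[OF ideal.axioms(1)[OF ideal_ideal_gen] assms]
  by (simp add: a_inv_free_algebra)

lemma ideal_gen_diff:
  assumes "f \<in> ideal_gen S" "g \<in> ideal_gen S"
  shows "f - g \<in> ideal_gen S"
  using ideal_gen_add[OF assms(1) ideal_gen_uminus[OF assms(2)]] by simp


theorem mainTheorem1:
  fixes E :: "((letter, 'k::field) ncpoly \<times> (letter, 'k) ncpoly) set"
    and A :: "('k, (letter, 'k) ncpoly set) module"
    and S :: "(letter, 'k) ncpoly set"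
  assumes E: "E = {
      (x\<^sub>2 * x\<^sub>1, x\<^sub>1 * x\<^sub>2),
      (y\<^sub>2 * y\<^sub>1, y\<^sub>1 * y\<^sub>2 + y\<^sub>1 ^ 2),
      (y\<^sub>1 * x\<^sub>1, x\<^sub>1 * y\<^sub>1),
      (y\<^sub>2 * x\<^sub>1, x\<^sub>1 * y\<^sub>2),
      (y\<^sub>1 * x\<^sub>2, x\<^sub>2 * y\<^sub>1 + x\<^sub>1 * y\<^sub>2),
      (y\<^sub>2 * x\<^sub>2, scale (- 2) (x\<^sub>2 * y\<^sub>1) - x\<^sub>1 * y\<^sub>2 + x\<^sub>2 * y\<^sub>2)}"
    and A: "A = presented_algebra E"
    and S: "S = {
      x\<^sub>2 * x\<^sub>1 - x\<^sub>1 * x\<^sub>2,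
      x\<^sub>1 * y\<^sub>1 - y\<^sub>1 * x\<^sub>1,
      x\<^sub>1 * y\<^sub>2 - y\<^sub>2 * x\<^sub>1,
      y\<^sub>2 * y\<^sub>1 - y\<^sub>1 * y\<^sub>2 - y\<^sub>1 ^ 2,
      x\<^sub>2 * y\<^sub>1 - y\<^sub>1 * x\<^sub>2 + y\<^sub>2 * x\<^sub>1,
      x\<^sub>2 * y\<^sub>2 - y\<^sub>2 * x\<^sub>2 - scale 2 (y\<^sub>1 * x\<^sub>2) + y\<^sub>2 * x\<^sub>1}"
  shows "GS_basis S \<and> relations_ideal E = ideal_gen S \<and> A = quotient_algebra free_algebra (ideal_gen S)"
proof -
  have S': "S = gs_set"
    by (simp add: S gs_set_def s_defs)

  define e1 e2 e3 e4 e5 e6 :: "(letter, 'k) ncpoly" where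
    "e1 = x\<^sub>2 * x\<^sub>1 - x\<^sub>1 * x\<^sub>2" and
    "e2 = y\<^sub>2 * y\<^sub>1 - (y\<^sub>1 * y\<^sub>2 + y\<^sub>1 ^ 2)" and
    "e3 = y\<^sub>1 * x\<^sub>1 - x\<^sub>1 * y\<^sub>1" and
    "e4 = y\<^sub>2 * x\<^sub>1 - x\<^sub>1 * y\<^sub>2" and
    "e5 = y\<^sub>1 * x\<^sub>2 - (x\<^sub>2 * y\<^sub>1 + x\<^sub>1 * y\<^sub>2)" and
    "e6 = y\<^sub>2 * x\<^sub>2 - (scale (- 2) (x\<^sub>2 * y\<^sub>1) - x\<^sub>1 * y\<^sub>2 + x\<^sub>2 * y\<^sub>2)"
  note e_defs = this
  define D where "D = {e1, e2, e3, e4, e5, e6}"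
  have "{l - r | l r. (l, r) \<in> E} = D"
    unfolding E D_def e_defs by auto
  then have rel: "relations_ideal E = ideal_gen D"
    by (simp add: relations_ideal_def)

  have D_in: "e1 \<in> ideal_gen D" "e2 \<in> ideal_gen D" "e3 \<in> ideal_gen D"
    "e4 \<in> ideal_gen D" "e5 \<in> ideal_gen D" "e6 \<in> ideal_gen D"
    by (simp_all add: ideal_gen_base D_def)
  have s_e: "s_x2x1 = e1" "s_x1y1 = - e3" "s_x1y2 = - e4" "s_y2y1 = e2"
    "s_x2y1 = e4 - e5" "s_x2y2 = e4 - e5 - e5 - e6"
    by (simp_all add: s_defs e_defs scale_numerals algebra_simps)
  have "gs_set \<subseteq> ideal_gen D"
    unfolding gs_set_def s_e
    by (intro insert_subsetI empty_subsetI ideal_gen_diff ideal_gen_uminus D_in)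
  moreover
  have S_in: "s_x2x1 \<in> ideal_gen gs_set" "s_x1y1 \<in> ideal_gen gs_set" "s_x1y2 \<in> ideal_gen gs_set"
    "s_y2y1 \<in> ideal_gen gs_set" "s_x2y1 \<in> ideal_gen gs_set" "s_x2y2 \<in> ideal_gen gs_set"
    by (simp_all add: ideal_gen_base gs_set_def)
  have e_s: "e1 = s_x2x1" "e2 = s_y2y1" "e3 = - s_x1y1" "e4 = - s_x1y2"
    "e5 = - s_x1y2 - s_x2y1" "e6 = s_x1y2 + s_x2y1 + s_x2y1 - s_x2y2"
    by (simp_all add: s_defs e_defs scale_numerals algebra_simps)
  have "D \<subseteq> ideal_gen gs_set"
    unfolding D_def e_s
    by (intro insert_subsetI empty_subsetI ideal_gen_add ideal_gen_diff ideal_gen_uminus S_in)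
  ultimately have "relations_ideal E = ideal_gen S"
    unfolding rel S' by (intro equalityI ideal_gen_subset)
  then show ?thesis
    using GS_basis_gs_set by (simp add: A presented_algebra_def S')
qed

end
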